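(* For every $d\in\mathbb{N}$ and every graph class $\mathscr C$ of bounded expansion, there exists $s\in\mathbb{N}$ such that for every $G\in\mathscr C$, every $W\subseteq V(G)$ and every $\mathcal{Q}\subseteq\{\mathsf{Ball}^G_d(u): u\in V(G)\}$, the set system $(W,\{F\cap W: F\in\mathcal{Q}\})$ has subchromatic number at most $s$. (That is, the hereditary closure of the class of set systems $\mathsf{Balls}_d(\mathscr C)$ has bounded subchromatic number.)
   Context: Graphs are finite, simple, undirected. $\mathsf{Ball}^G_d(u)=\{v\in V(G):\mathrm{dist}_G(u,v)\le d\}$, and $\mathsf{Balls}_d(G)=(V(G),\{\mathsf{Ball}^G_d(u):u\in V(G)\})$. For a set system $(U,\mathcal{F})$ its Gaifman graph has vertex set $U$, with distinct $x,y$ adjacent iff some $F\in\mathcal{F}$ contains both. A cluster graph is a graph whose every connected component is a clique; a subcoloring of a graph $G$ is a map $\lambda\colon V(G)\to C$ (finite $C$) such that $G[\lambda^{-1}(i)]$ is a cluster graph for each $i$; the subchromatic number of a graph is the minimum number of colors of a subcoloring, and that of a set system is the subchromatic number of its Gaifman graph. A graph $H$ is a depth-$d$ minor of $G$ if one can assign to each $u\in V(H)$ a connected subgraph $\eta(u)$ of $G$ of radius at most $d$, pairwise vertex-disjoint, such that each edge $uv$ of $H$ has a corresponding edge of $G$ between $\eta(u)$ and $\eta(v)$; $\mathscr C$ has bounded expansion if for each $d$ the maximum average degree of depth-$d$ minors of graphs in $\mathscr C$ is bounded. *)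

theory Defs
  imports "Graph_Theory.Graph_Theory"
begin

text \<open>
  Finite simple undirected graphs are represented, as in the library, by symmetric loop-free
  finite digraphs (\<^locale>\<open>pair_graph\<close>): an edge \<open>uv\<close> is the pair of arcs \<open>(u,v)\<close> and \<open>(v,u)\<close>.
\<close>

text \<open>Infinite if \<open>v\<close> is not reachable from \<open>u\<close>.\<close>

definition graph_dist :: "'a pair_pre_digraph \<Rightarrow> 'a \<Rightarrow> 'a \<Rightarrow> ereal" where
  "graph_dist G u v = wf_digraph.\<mu> (with_proj G) (\<lambda>_. 1) u v"

definition graph_ball :: "nat \<Rightarrow> 'a pair_pre_digraph \<Rightarrow> 'a \<Rightarrow> 'a set" where
  "graph_ball d G u = {v \<in> pverts G. graph_dist G u v \<le> ereal (real d)}"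

type_synonym 'a set_system = "'a set \<times> 'a set set"

definition balls_system :: "nat \<Rightarrow> 'a pair_pre_digraph \<Rightarrow> 'a set_system" where
  "balls_system d G = (pverts G, graph_ball d G ` pverts G)"

definition gaifman_graph :: "'a set_system \<Rightarrow> 'a pair_pre_digraph" where
  "gaifman_graph S =
     \<lparr> pverts = fst S,
       parcs = {(x, y). x \<in> fst S \<and> y \<in> fst S \<and> x \<noteq> y \<and> (\<exists>F\<in>snd S. x \<in> F \<and> y \<in> F)} \<rparr>"

text \<open>
  In a symmetric digraph the strongly connected components are the connected components of the
  underlying undirected graph.
\<close>

definition cluster_graph :: "('a, 'b) pre_digraph \<Rightarrow> bool" where
  "cluster_graph G \<longleftrightarrow> (\<forall>K\<in>pre_digraph.sccs G. \<exists>n. complete_digraph n K)"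

definition subcoloring :: "'a pair_pre_digraph \<Rightarrow> 'c set \<Rightarrow> ('a \<Rightarrow> 'c) \<Rightarrow> bool" where
  "subcoloring G C f \<longleftrightarrow>
     finite C \<and> f ` pverts G \<subseteq> C \<and>
     (\<forall>i\<in>C. cluster_graph (with_proj G \<restriction> {v \<in> pverts G. f v = i}))"

definition subchromatic_number :: "'a pair_pre_digraph \<Rightarrow> nat" where
  "subchromatic_number G =
     (LEAST k. \<exists>(C :: nat set) f. subcoloring G C f \<and> card C = k)"

text \<open>The minimum defining the subchromatic number of a finite graph exists.\<close>

lemma subcoloring_exists:
  assumes "pair_graph G"
  shows "\<exists>(C :: nat set) f. subcoloring G C f"
proof -
  interpret pair_graph G by fact
  obtain f :: "'a \<Rightarrow> nat" where f: "inj_on f (pverts G)"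
    using pair_finite_verts finite_imp_inj_to_nat_seg by metis
  have "complete_digraph (card (verts K)) K"
    if K: "K \<in> pre_digraph.sccs (with_proj G \<restriction> {v \<in> pverts G. f v = i})" for i K
  proof -
    let ?I = "with_proj G \<restriction> {v \<in> pverts G. f v = i}"
    have ind: "induced_subgraph K ?I"
      using K by (auto simp: pre_digraph.sccs_def)
    hence sub: "verts K \<subseteq> {v \<in> pverts G. f v = i}" "arcs K \<subseteq> arcs ?I" and wf: "wf_digraph K"
      by (auto simp: induced_subgraph_def subgraph_def)
    have same: "u = v" if "u \<in> verts K" "v \<in> verts K" for u v
      using that sub(1) inj_onD[OF f, of u v] by auto
    have "arcs ?I = {}"
      using inj_onD[OF f] no_loops' by fastforce
    hence arcs: "arcs K = {}" using sub by blast
    have "finite (verts K)"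
      using sub pair_finite_verts by (auto intro: finite_subset)
    hence "graph K"
      using wf arcs
      by (auto simp: graph_def digraph_def pseudo_graph_def fin_digraph_def fin_digraph_axioms_def
          loopfree_digraph_def loopfree_digraph_axioms_def nomulti_digraph_def
          nomulti_digraph_axioms_def sym_digraph_def sym_digraph_axioms_def symmetric_conv)
    thus ?thesis
      using arcs same by (auto simp: complete_digraph_def arcs_ends_def)
  qed
  hence "subcoloring G (f ` pverts G) f"
    using pair_finite_verts unfolding subcoloring_def cluster_graph_def by blast
  thus ?thesis by blast
qed

definition set_system_subchromatic_number :: "'a set_system \<Rightarrow> nat" where
  "set_system_subchromatic_number S = subchromatic_number (gaifman_graph S)"

definition graph_radius :: "'a pair_pre_digraph \<Rightarrow> ereal" where
  "graph_radius G = (INF c\<in>pverts G. SUP v\<in>pverts G. graph_dist G c v)"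

definition depth_minor ::
    "nat \<Rightarrow> 'b pair_pre_digraph \<Rightarrow> 'a pair_pre_digraph \<Rightarrow> bool" where
  "depth_minor d H G \<longleftrightarrow>
     (\<exists>\<eta> :: 'b \<Rightarrow> 'a pair_pre_digraph.
        (\<forall>u\<in>pverts H. pair_graph (\<eta> u) \<and> subgraph (with_proj (\<eta> u)) (with_proj G) \<and>
           Digraph_Component.connected (with_proj (\<eta> u)) \<and>
           graph_radius (\<eta> u) \<le> ereal (real d)) \<and>
        (\<forall>u\<in>pverts H. \<forall>v\<in>pverts H. u \<noteq> v \<longrightarrow> pverts (\<eta> u) \<inter> pverts (\<eta> v) = {}) \<and>
        (\<forall>(u, v)\<in>parcs H. \<exists>x\<in>pverts (\<eta> u). \<exists>y\<in>pverts (\<eta> v). (x, y) \<in> parcs G))"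

text \<open>
  In a symmetric digraph the out-degree is the degree of the undirected graph.  The average
  degree of the graph without vertices is \<open>0\<close>.
\<close>

definition average_degree :: "'a pair_pre_digraph \<Rightarrow> real" where
  "average_degree G =
     (\<Sum>v\<in>pverts G. real (out_degree (with_proj G) v)) / real (card (pverts G))"

text \<open>
  The minors range over graphs with vertices in the same type as those of the class. This is no
  restriction up to isomorphism, since a minor of \<open>G\<close> has at most as many vertices as \<open>G\<close>.
\<close>

definition bounded_expansion :: "'a pair_pre_digraph set \<Rightarrow> bool" where
  "bounded_expansion \<C> \<longleftrightarrow>
     (\<forall>d :: nat. \<exists>b :: real. \<forall>G\<in>\<C>. \<forall>H :: 'a pair_pre_digraph.
        pair_graph H \<and> depth_minor d H G \<longrightarrow> average_degree H \<le> b)"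

end

theory Submission
  imports Defs
begin

text \<open>
  Fix a linear order on the vertices and let \<open>Z x\<close> consist of the vertices \<open>z\<close> with
  \<open>dist x z + dist z A \<le> d\<close>, where \<open>A\<close> is the set of centres of the chosen balls.  Colouring \<open>x\<close> by a
  colour of the least element of \<open>Z x\<close> is a subcolouring as soon as vertices that are weakly
  \<open>4d\<close>-reachable from each other have different colours, so the theorem reduces to an order with
  bounded weak colouring numbers.  Such an order is built from its greatest element downwards: by
  sparsity of shallow minors, every nonempty set \<open>S\<close> of vertices has an element \<open>v\<close> for which a bounded
  set \<open>X\<close> meets all short paths from \<open>v\<close> to the rest of \<open>S\<close> with interior outside \<open>S\<close>.  A path witnessing
  weak reachability from \<open>v\<close> then meets \<open>X\<close>, and induction on its length bounds the number of weakly
  reachable vertices.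
\<close>

section \<open>Walks of bounded length inside a vertex set\<close>

text \<open>Only the vertices after the start have to lie in \<open>U\<close>. This allows walks
  that start in a set and then have to stay outside it.\<close>

primrec reach_in :: "('a \<times> 'a) set \<Rightarrow> 'a set \<Rightarrow> nat \<Rightarrow> 'a \<Rightarrow> 'a set" where
  "reach_in E U 0 v = {v}"
| "reach_in E U (Suc n) v = reach_in E U n v \<union> {y \<in> U. \<exists>x\<in>reach_in E U n v. (x, y) \<in> E}"

lemma reach_in_self [simp]: "v \<in> reach_in E U n v"
  by (induction n) auto

lemma reach_in_subset: "reach_in E U n v \<subseteq> insert v U"
  by (induction n) auto

lemma reach_in_mono: "U \<subseteq> U' \<Longrightarrow> m \<le> n \<Longrightarrow> reach_in E U m v \<subseteq> reach_in E U' n v"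
proof (induction n)
  case 0
  then show ?case by simp
next
  case (Suc n)
  have *: "reach_in E U k v \<subseteq> reach_in E U' k v" for k
    using Suc.prems(1) by (induction k) auto
  show ?case
  proof (cases "m = Suc n")
    case True
    then show ?thesis using * by blast
  next
    case False
    then show ?thesis using Suc by auto
  qed
qed

lemma reach_in_step:
  "x \<in> reach_in E U m v \<Longrightarrow> (x, y) \<in> E \<Longrightarrow> y \<in> U \<Longrightarrow> m < n \<Longrightarrow> y \<in> reach_in E U n v"
  using reach_in_mono[of U U "Suc m" n E v] by auto

lemma reach_in_trans:
  "z \<in> reach_in E U n y \<Longrightarrow> y \<in> reach_in E U m x \<Longrightarrow> z \<in> reach_in E U (m + n) x"
  by (induction n arbitrary: z) auto

lemma reach_in_Suc_left:
  assumes "(x, y) \<in> E" "y \<in> U" "z \<in> reach_in E U n y"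
  shows "z \<in> reach_in E U (Suc n) x"
  using reach_in_trans[OF assms(3), of 1 x] assms(1,2) by auto

lemma reach_in_sym:
  assumes "sym E" "v \<in> U"
  shows "x \<in> reach_in E U n v \<Longrightarrow> v \<in> reach_in E U n x"
proof (induction n arbitrary: x)
  case 0
  then show ?case by simp
next
  case (Suc n)
  show ?case
  proof (cases "x \<in> reach_in E U n v")
    case True
    then show ?thesis using Suc.IH by auto
  next
    case False
    then obtain y where y: "y \<in> reach_in E U n v" "(y, x) \<in> E" using Suc.prems by auto
    then have "y \<in> U" using assms(2) reach_in_subset[of E U n v] by auto
    then show ?thesis
      using reach_in_Suc_left[of x y E U v n] Suc.IH[OF y(1)] y(2) assms(1) by (auto dest: symD)
  qed
qed

text \<open>Every vertex on a walk of length at most \<open>n\<close> is itself reached within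
  \<open>n\<close> steps, so the walk never leaves the ball. Balls can therefore serve as branch
  sets of radius \<open>n\<close>.\<close>

lemma reach_in_idem: "x \<in> reach_in E U n v \<Longrightarrow> x \<in> reach_in E (reach_in E U n v) n v"
proof (induction n arbitrary: x)
  case 0
  then show ?case by simp
next
  case (Suc n)
  have "reach_in E (reach_in E U n v) n v \<subseteq> reach_in E (reach_in E U (Suc n) v) n v"
    by (rule reach_in_mono) auto
  then show ?case using Suc by auto
qed

text \<open>The walk is cut at its first vertex in \<open>Y\<close> after the start. The edge
  entering \<open>Y\<close> is split off: \<open>i\<close> bounds the steps before it, and
  \<open>n - Suc i\<close> steps remain.\<close>

lemma reach_in_first_hit:
  assumes "y \<in> reach_in E U n v"
  shows "y \<in> reach_in E (U - Y) n v \<or>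
    (\<exists>i<n. \<exists>z\<in>reach_in E (U - Y) i v. \<exists>x\<in>Y \<inter> U. (z, x) \<in> E \<and> y \<in> reach_in E U (n - Suc i) x)"
  using assms
proof (induction n arbitrary: y)
  case 0
  then show ?case by simp
next
  case (Suc n)
  have keep: ?case if "i < n" "z \<in> reach_in E (U - Y) i v" "x \<in> Y \<inter> U" "(z, x) \<in> E"
    "y \<in> reach_in E U (Suc n - Suc i) x" for i z x
    using that less_SucI[OF that(1)] by blast
  show ?case
  proof (cases "y \<in> reach_in E U n v")
    case True
    from Suc.IH[OF this] show ?thesis
    proof
      assume "\<exists>i<n. \<exists>z\<in>reach_in E (U - Y) i v. \<exists>x\<in>Y \<inter> U. (z, x) \<in> E \<and> y \<in> reach_in E U (n - Suc i) x"
      then obtain i z x where *: "i < n" "z \<in> reach_in E (U - Y) i v" "x \<in> Y \<inter> U" "(z, x) \<in> E"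
        "y \<in> reach_in E U (n - Suc i) x" by blast
      have "n - Suc i \<le> Suc n - Suc i" by linarith
      from reach_in_mono[OF subset_refl this] *(5) have "y \<in> reach_in E U (Suc n - Suc i) x" ..
      then show ?thesis by (rule keep[OF *(1-4)])
    qed auto
  next
    case False
    then obtain u where u: "u \<in> reach_in E U n v" "(u, y) \<in> E" and y: "y \<in> U"
      using Suc.prems by auto
    from Suc.IH[OF u(1)] show ?thesis
    proof
      assume *: "u \<in> reach_in E (U - Y) n v"
      show ?thesis
      proof (cases "y \<in> Y")
        case True
        then show ?thesis using * u(2) y by (intro disjI2 exI[of _ n]) auto
      next
        case False
        then show ?thesis using * u(2) y by auto
      qed
    next
      assume "\<exists>i<n. \<exists>z\<in>reach_in E (U - Y) i v. \<exists>x\<in>Y \<inter> U. (z, x) \<in> E \<and> u \<in> reach_in E U (n - Suc i) x"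
      then obtain i z x where *: "i < n" "z \<in> reach_in E (U - Y) i v" "x \<in> Y \<inter> U" "(z, x) \<in> E"
        "u \<in> reach_in E U (n - Suc i) x" by blast
      have "y \<in> reach_in E U (Suc n - Suc i) x"
        by (rule reach_in_step[OF *(5) u(2) y]) (use *(1) in auto)
      then show ?thesis by (rule keep[OF *(1-4)])
    qed
  qed
qed

text \<open>\<open>T\<close> collects the vertices after the start on one walk to \<open>x\<close>.
  As each of them is reached inside \<open>T\<close>, it can be added to a branch set centred at
  \<open>v\<close> without raising the radius above \<open>n\<close>.\<close>

lemma reach_in_small_support:
  assumes "x \<in> reach_in E U n v"
  shows "\<exists>T\<subseteq>U. finite T \<and> card T \<le> n \<and> x \<in> insert v T \<and> T \<subseteq> reach_in E T n v"
  using assms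
proof (induction n arbitrary: x)
  case 0
  then show ?case by (intro exI[of _ "{}"]) auto
next
  case (Suc n)
  show ?case
  proof (cases "x \<in> reach_in E U n v")
    case True
    from Suc.IH[OF this] obtain T where "T \<subseteq> U" "finite T" "card T \<le> n" "x \<in> insert v T"
      "T \<subseteq> reach_in E T n v" by blast
    then show ?thesis by (intro exI[of _ T]) auto
  next
    case False
    then obtain y where y: "y \<in> reach_in E U n v" "(y, x) \<in> E" "x \<in> U" using Suc.prems by auto
    from Suc.IH[OF y(1)] obtain T where T: "T \<subseteq> U" "finite T" "card T \<le> n" "y \<in> insert v T"
      "T \<subseteq> reach_in E T n v" by blast
    have *: "insert v T \<subseteq> reach_in E (insert x T) n v"
      using T(5) reach_in_mono[of T "insert x T" n n E v] by auto
    show ?thesis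
      using T(1-4) y * by (intro exI[of _ "insert x T"]) (auto simp: card_insert_if)
  qed
qed

text \<open>A walk that meets \<open>T\<close> is stopped just before it first enters
  \<open>T\<close>. This keeps the second of two connecting paths disjoint from the first.\<close>

lemma reach_in_avoid_or_touch:
  assumes "y \<in> reach_in E U n v"
  shows "y \<in> reach_in E (U - T) n v \<or> (\<exists>y'\<in>reach_in E (U - T) n v. \<exists>t\<in>T. (y', t) \<in> E)"
  using assms
proof (induction n arbitrary: y)
  case 0
  then show ?case by simp
next
  case (Suc n)
  show ?case
  proof (cases "y \<in> reach_in E U n v")
    case True
    from Suc.IH[OF this] show ?thesis by auto
  next
    case False
    then obtain x where x: "x \<in> reach_in E U n v" "(x, y) \<in> E" and y: "y \<in> U"
      using Suc.prems by auto
    from Suc.IH[OF x(1)] show ?thesis using x(2) y by (cases "y \<in> T") auto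
  qed
qed

section \<open>Shallow minors and small separators\<close>

text \<open>The vertices of the minor are named by the centres of their branch sets, so the minor
  lives in the vertex type of the graph and \<open>n\<close> bounds the radius as seen from that
  centre.\<close>

definition branch_sets :: "'a set \<Rightarrow> ('a \<times> 'a) set \<Rightarrow> nat \<Rightarrow> 'a set \<Rightarrow> ('a \<Rightarrow> 'a set) \<Rightarrow> bool" where
  "branch_sets V E n K B \<longleftrightarrow>
     (\<forall>v\<in>K. v \<in> B v \<and> B v \<subseteq> V \<and> B v \<subseteq> reach_in E (B v) n v) \<and>
     (\<forall>u\<in>K. \<forall>v\<in>K. u \<noteq> v \<longrightarrow> B u \<inter> B v = {})"

definition branch_adj :: "('a \<times> 'a) set \<Rightarrow> 'a set \<Rightarrow> ('a \<Rightarrow> 'a set) \<Rightarrow> ('a \<times> 'a) set" where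
  "branch_adj E K B = {(u, v). u \<in> K \<and> v \<in> K \<and> u \<noteq> v \<and> (\<exists>x\<in>B u. \<exists>y\<in>B v. (x, y) \<in> E)}"

text \<open>\<open>R\<close> is the arc set of a minor with every edge counted in both directions.
  Thus \<open>card R\<close> is a degree sum, and \<open>b\<close> bounds the average degree of
  depth-\<open>n\<close> minors.\<close>

definition minors_bounded :: "'a set \<Rightarrow> ('a \<times> 'a) set \<Rightarrow> nat \<Rightarrow> nat \<Rightarrow> bool" where
  "minors_bounded V E n b \<longleftrightarrow>
     (\<forall>K B R. K \<subseteq> V \<longrightarrow> branch_sets V E n K B \<longrightarrow> R \<subseteq> branch_adj E K B \<longrightarrow> sym R \<longrightarrow>
        card R \<le> b * card K)"

lemma sym_branch_adj: "sym E \<Longrightarrow> sym (branch_adj E K B)"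
  unfolding branch_adj_def sym_def by blast

lemma branch_adj_subset: "branch_adj E K B \<subseteq> K \<times> K"
  unfolding branch_adj_def by auto

text \<open>
  Enlarging the branch sets along a short connection outside all of them pays for the new vertices
  with a new adjacency, so a family with a maximum number of adjacencies admits no such connection.
\<close>

lemma saturated_branch_sets:
  assumes fin: "finite V" and sym: "sym E" and S: "S \<subseteq> V"
  obtains B where "branch_sets V E n S B"
    and "card (\<Union>(B ` S) - S) \<le> n * card (branch_adj E S B)"
    and "\<And>u v x y. \<lbrakk>u \<in> S; v \<in> S; u \<noteq> v; x \<in> reach_in E (V - \<Union>(B ` S)) n u;
           y \<in> reach_in E (V - \<Union>(B ` S)) n v; x = y \<or> (x, y) \<in> E\<rbrakk> \<Longrightarrow> (u, v) \<in> branch_adj E S B"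
proof -
  \<comment> \<open>The cardinality condition is the invariant of the enlargement: each arc between
    branch sets pays for at most \<open>n\<close> vertices outside \<open>S\<close>.\<close>
  define good where
    "good B \<longleftrightarrow> branch_sets V E n S B \<and> card (\<Union>(B ` S) - S) \<le> n * card (branch_adj E S B)" for B
  have finS: "finite S" using S fin by (rule finite_subset)
  have finadj: "finite (branch_adj E S B)" for B
    by (rule finite_subset[OF branch_adj_subset]) (simp add: finS)
  have "good (\<lambda>v. {v})"
    using S unfolding good_def branch_sets_def by auto
  moreover have "card (branch_adj E S B) < Suc (card (S \<times> S))" for B
    using finS by (intro le_imp_less_Suc card_mono branch_adj_subset) simp
  ultimately have "\<exists>B. good B \<and> (\<forall>B'. good B' \<longrightarrow> card (branch_adj E S B') \<le> card (branch_adj E S B))"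
    by (intro ex_has_greatest_nat[where b = "Suc (card (S \<times> S))"]) blast+
  then obtain B where B: "good B"
    and max: "\<And>B'. good B' \<Longrightarrow> card (branch_adj E S B') \<le> card (branch_adj E S B)"
    by blast
  define U where "U = V - \<Union>(B ` S)"
  have SB: "v \<in> B v" "B v \<subseteq> V" "B v \<subseteq> reach_in E (B v) n v" if "v \<in> S" for v
    using B that unfolding good_def branch_sets_def by auto
  have disj: "B u \<inter> B v = {}" if "u \<in> S" "v \<in> S" "u \<noteq> v" for u v
    using B that unfolding good_def branch_sets_def by auto
  have US: "U \<inter> S = {}" using SB(1) unfolding U_def by auto
  have sat: "(u, v) \<in> branch_adj E S B"
    if uv: "u \<in> S" "v \<in> S" "u \<noteq> v" and x: "x \<in> reach_in E U n u" and y: "y \<in> reach_in E U n v"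
      and xy: "x = y \<or> (x, y) \<in> E" for u v x y
  proof (rule ccontr)
    assume new: "(u, v) \<notin> branch_adj E S B"
    obtain T where T: "T \<subseteq> U" "finite T" "card T \<le> n" "x \<in> insert u T" "T \<subseteq> reach_in E T n u"
      using reach_in_small_support[OF x] by blast
    \<comment> \<open>The path from \<open>v\<close> may cross the path \<open>T\<close> from
      \<open>u\<close>. If it avoids \<open>T\<close>, then \<open>x = y\<close> is impossible and
      the given edge serves; otherwise its part before \<open>T\<close> already ends next to
      \<open>T\<close>.\<close>
    have "\<exists>y'\<in>reach_in E (U - T) n v. \<exists>t\<in>insert u T. (y', t) \<in> E"
    proof (cases "y \<in> reach_in E (U - T) n v")
      case True
      have "y \<notin> insert u T"
        using True reach_in_subset[of E "U - T" n v] uv US T(1) by blast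
      then have "(y, x) \<in> E" using xy T(4) sym by (auto dest: symD)
      then show ?thesis using True T(4) by blast
    next
      case False
      then show ?thesis using reach_in_avoid_or_touch[OF y, of T] by blast
    qed
    then obtain y' t where y': "y' \<in> reach_in E (U - T) n v" and t: "t \<in> insert u T" "(y', t) \<in> E"
      by blast
    obtain T' where T': "T' \<subseteq> U - T" "finite T'" "card T' \<le> n" "y' \<in> insert v T'"
      "T' \<subseteq> reach_in E T' n v"
      using reach_in_small_support[OF y'] by blast
    define B' where "B' = B(u := B u \<union> T, v := B v \<union> T')"
    have B'u: "B' u = B u \<union> T" and B'v: "B' v = B v \<union> T'"
      and B'w: "\<And>w. w \<noteq> u \<Longrightarrow> w \<noteq> v \<Longrightarrow> B' w = B w"
      using uv by (auto simp: B'_def)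
    have UB: "U \<inter> B w = {}" if "w \<in> S" for w using that unfolding U_def by auto
    have ext: "A \<union> C \<subseteq> reach_in E (A \<union> C) n w"
      if "A \<subseteq> reach_in E A n w" "C \<subseteq> reach_in E C n w" for A C w
      using that reach_in_mono[of A "A \<union> C" n n E w] reach_in_mono[of C "A \<union> C" n n E w] by blast
    have "w \<in> B' w \<and> B' w \<subseteq> V \<and> B' w \<subseteq> reach_in E (B' w) n w" if "w \<in> S" for w
    proof -
      consider "w = u" | "w = v" | "w \<noteq> u" "w \<noteq> v" by blast
      then show ?thesis
      proof cases
        case 1
        moreover have "B u \<union> T \<subseteq> V" using SB(2)[OF uv(1)] T(1) unfolding U_def by blast
        ultimately show ?thesis using ext[OF SB(3)[OF uv(1)] T(5)] SB(1)[OF uv(1)] by (simp add: B'u)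
      next
        case 2
        moreover have "B v \<union> T' \<subseteq> V" using SB(2)[OF uv(2)] T'(1) unfolding U_def by blast
        ultimately show ?thesis using ext[OF SB(3)[OF uv(2)] T'(5)] SB(1)[OF uv(2)] by (simp add: B'v)
      next
        case 3
        then show ?thesis using SB[OF that] by (simp add: B'w)
      qed
    qed
    moreover have "B' w \<inter> B' z = {}" if wz: "w \<in> S" "z \<in> S" "w \<noteq> z" for w z
    proof -
      \<comment> \<open>\<open>C q\<close> is what the branch set of \<open>q\<close> gains. These
        pieces are disjoint from each other and, lying in \<open>U\<close>, from all old branch
        sets.\<close>
      define C where "C q = (if q = u then T else if q = v then T' else {})" for q
      have "B' q = B q \<union> C q" for q
        using B'u B'v B'w by (simp add: C_def)
      moreover have "C w \<inter> C z = {}" using wz(3) T'(1) by (auto simp: C_def)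
      moreover have "C q \<subseteq> U" for q using T(1) T'(1) by (auto simp: C_def)
      ultimately show ?thesis
        using disj[OF wz] UB[OF wz(1)] UB[OF wz(2)] by (simp add: Int_Un_distrib Int_Un_distrib2) blast
    qed
    ultimately have "branch_sets V E n S B'" unfolding branch_sets_def by blast
    moreover have adj: "insert (u, v) (insert (v, u) (branch_adj E S B)) \<subseteq> branch_adj E S B'"
    proof -
      have BB': "B w \<subseteq> B' w" for w unfolding B'_def by auto
      then have "branch_adj E S B \<subseteq> branch_adj E S B'"
        unfolding branch_adj_def by blast
      moreover have "(v, u) \<in> branch_adj E S B'"
      proof -
        have "t \<in> B' u" "y' \<in> B' v"
          using t(1) T'(4) SB(1) uv by (auto simp: B'u B'v)
        then show ?thesis using uv t(2) unfolding branch_adj_def by blast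
      qed
      ultimately show ?thesis using sym_branch_adj[OF sym, of S B'] by (auto dest: symD)
    qed
    \<comment> \<open>Both \<open>(u, v)\<close> and \<open>(v, u)\<close> are new arcs, which pays
      for the at most \<open>n + n\<close> vertices of \<open>T\<close> and
      \<open>T'\<close>.\<close>
    then have more: "card (branch_adj E S B) + 2 \<le> card (branch_adj E S B')"
    proof -
      have "(v, u) \<notin> branch_adj E S B"
        using new sym_branch_adj[OF sym, of S B] by (auto dest: symD)
      then have "card (insert (u, v) (insert (v, u) (branch_adj E S B))) = card (branch_adj E S B) + 2"
        using new uv finadj by simp
      then show ?thesis using card_mono[OF finadj adj] by simp
    qed
    moreover have "card (\<Union>(B' ` S) - S) \<le> n * card (branch_adj E S B')"
    proof -
      have sub: "\<Union>(B' ` S) - S \<subseteq> (\<Union>(B ` S) - S) \<union> (T \<union> T')"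
        unfolding B'_def by (auto split: if_splits)
      have "finite ((\<Union>(B ` S) - S) \<union> (T \<union> T'))"
        using T(2) T'(2) SB(2) fin finS by (auto intro: finite_subset)
      from card_mono[OF this sub]
      have "card (\<Union>(B' ` S) - S) \<le> card (\<Union>(B ` S) - S) + (card T + card T')"
        using card_Un_le[of "\<Union>(B ` S) - S" "T \<union> T'"] card_Un_le[of T T'] by linarith
      also have "\<dots> \<le> n * card (branch_adj E S B) + (n + n)"
        using B T(3) T'(3) unfolding good_def by linarith
      also have "\<dots> = n * (card (branch_adj E S B) + 2)" by simp
      also have "\<dots> \<le> n * card (branch_adj E S B')" using more by (rule mult_le_mono2)
      finally show ?thesis .
    qed
    ultimately have "good B'" unfolding good_def by blast
    from max[OF this] more show False by simp
  qed
  show ?thesis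
  proof (rule that)
    show "branch_sets V E n S B" "card (\<Union>(B ` S) - S) \<le> n * card (branch_adj E S B)"
      using B unfolding good_def by simp_all
  qed (rule sat[unfolded U_def])
qed

text \<open>By averaging, at least half of the vertices have degree at most \<open>2 * b\<close>. A
  maximum independent set among these dominates all of them, and each member dominates at most
  \<open>2 * b + 1\<close> vertices, itself included.\<close>

lemma low_degree_independent_set:
  assumes fin: "finite S" and R: "R \<subseteq> S \<times> S" "sym R" and card: "card R \<le> b * card S"
  obtains I where "I \<subseteq> S" "\<And>u v. u \<in> I \<Longrightarrow> v \<in> I \<Longrightarrow> (u, v) \<notin> R \<or> u = v"
    "\<And>v. v \<in> I \<Longrightarrow> card (R `` {v}) \<le> 2 * b" "card S \<le> 2 * (2 * b + 1) * card I"
proof -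
  define L where "L = {v \<in> S. card (R `` {v}) \<le> 2 * b}"
  have finR: "finite (R `` X)" for X using R(1) fin by (auto intro: finite_subset)
  have "R = Sigma S (\<lambda>v. R `` {v})" using R(1) by auto
  then have "card R = (\<Sum>v\<in>S. card (R `` {v}))"
    using card_SigmaI[OF fin, of "\<lambda>v. R `` {v}"] finR by simp
  also have "\<dots> \<ge> (\<Sum>v\<in>S - L. card (R `` {v}))"
    by (rule sum_mono2) (use fin in auto)
  finally have "(\<Sum>v\<in>S - L. card (R `` {v})) \<le> b * card S" using card by simp
  moreover have "(\<Sum>v\<in>S - L. card (R `` {v})) \<ge> (\<Sum>v\<in>S - L. 2 * b + 1)"
    by (rule sum_mono) (auto simp: L_def)
  ultimately have *: "(2 * b + 1) * card (S - L) \<le> b * card S"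
    by (simp add: algebra_simps)
  have SL: "card S = card L + card (S - L)"
    using fin card_Un_disjoint[of L "S - L"] by (auto simp: L_def Un_absorb1)
  have half: "card S \<le> 2 * card L"
  proof (rule ccontr)
    assume "\<not> ?thesis"
    then have "card S < 2 * card (S - L)" using SL by simp
    then have "b * card S \<le> b * (2 * card (S - L))" and "card (S - L) > 0" by auto
    moreover have "(2 * b + 1) * card (S - L) = b * (2 * card (S - L)) + card (S - L)"
      by (simp add: algebra_simps)
    ultimately show False using * by linarith
  qed
  define ind where "ind I \<longleftrightarrow> I \<subseteq> L \<and> (\<forall>u\<in>I. \<forall>v\<in>I. (u, v) \<notin> R \<or> u = v)" for I
  have finL: "finite L" using fin by (auto simp: L_def)
  have "ind {}" by (simp add: ind_def)
  moreover have "card I < Suc (card L)" if "ind I" for I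
    using that finL by (auto simp: ind_def less_Suc_eq_le intro: card_mono)
  ultimately have "\<exists>I. ind I \<and> (\<forall>J. ind J \<longrightarrow> card J \<le> card I)"
    by (intro ex_has_greatest_nat[where b = "Suc (card L)"]) blast+
  then obtain I where I: "ind I" and max: "\<And>J. ind J \<Longrightarrow> card J \<le> card I" by blast
  have finI: "finite I" using I finL by (auto simp: ind_def intro: finite_subset)
  have "L \<subseteq> (\<Union>v\<in>I. insert v (R `` {v}))"
  proof
    fix w assume w: "w \<in> L"
    show "w \<in> (\<Union>v\<in>I. insert v (R `` {v}))"
    proof (rule ccontr)
      assume n: "\<not> ?thesis"
      then have "ind (insert w I)"
        using I w R(2) unfolding ind_def by (auto dest: symD)
      from max[OF this] n finI show False by auto
    qed
  qed
  then have "card L \<le> card (\<Union>v\<in>I. insert v (R `` {v}))"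
    using finI finR by (intro card_mono) auto
  also have "\<dots> \<le> (\<Sum>v\<in>I. card (insert v (R `` {v})))"
    by (rule card_UN_le[OF finI])
  also have "\<dots> \<le> (\<Sum>v\<in>I. 2 * b + 1)"
  proof (rule sum_mono)
    fix v assume "v \<in> I"
    then have "card (R `` {v}) \<le> 2 * b" using I by (auto simp: ind_def L_def)
    then show "card (insert v (R `` {v})) \<le> 2 * b + 1"
      using card_insert_le_m1 finR[of "{v}"] by (simp add: card_insert_if)
  qed
  finally have "card L \<le> (2 * b + 1) * card I" by (simp add: mult.commute)
  then have "card S \<le> 2 * (2 * b + 1) * card I" using half by simp
  then show ?thesis
    using I by (intro that[of I]) (auto simp: ind_def L_def)
qed

text \<open>The last edge is kept apart from the walk, so paths with up to \<open>n + 1\<close>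
  edges are covered: with interior outside \<open>S - {v}\<close>, such a path ends in
  \<open>S - {v}\<close> only if it meets \<open>X\<close> after its start.\<close>

definition separates :: "'a set \<Rightarrow> ('a \<times> 'a) set \<Rightarrow> nat \<Rightarrow> 'a set \<Rightarrow> 'a \<Rightarrow> 'a set \<Rightarrow> bool" where
  "separates V E n S v X \<longleftrightarrow>
     (\<forall>x\<in>reach_in E (V - (S - {v}) - X) n v. \<forall>s\<in>S - {v} - X. (x, s) \<notin> E)"

text \<open>Take an independent set \<open>I\<close> of low degree in the saturated minor
  \<open>H\<close>, and let \<open>M\<close> be the vertices of the branch sets outside
  \<open>S\<close>. By saturation the \<open>n\<close>-balls around \<open>I\<close> outside the
  branch sets are disjoint, so with the singletons of \<open>M\<close> they form a second minor. Its
  sparsity yields a \<open>v\<close> whose ball has few neighbours in \<open>M\<close>; these and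
  the \<open>H\<close>-neighbours of \<open>v\<close> form \<open>X\<close>.\<close>

lemma small_separator:
  assumes fin: "finite V" and sym: "sym E"
    and bound: "minors_bounded V E n b" and S: "S \<subseteq> V" "S \<noteq> {}"
  shows "\<exists>v\<in>S. \<exists>X\<subseteq>V. card X \<le> b * (1 + n * b * (2 * (2 * b + 1))) + 2 * b \<and> separates V E n S v X"
proof -
  obtain B where B: "branch_sets V E n S B"
    and cardM: "card (\<Union>(B ` S) - S) \<le> n * card (branch_adj E S B)"
    and sat: "\<And>u v x y. \<lbrakk>u \<in> S; v \<in> S; u \<noteq> v; x \<in> reach_in E (V - \<Union>(B ` S)) n u;
           y \<in> reach_in E (V - \<Union>(B ` S)) n v; x = y \<or> (x, y) \<in> E\<rbrakk> \<Longrightarrow> (u, v) \<in> branch_adj E S B"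
    using saturated_branch_sets[OF fin sym S(1), of n] by blast
  define H where "H = branch_adj E S B"
  define M where "M = \<Union>(B ` S) - S"
  define U where "U = V - \<Union>(B ` S)"
  have SB: "S \<subseteq> \<Union>(B ` S)" "\<Union>(B ` S) \<subseteq> V"
    using B unfolding branch_sets_def by blast+
  have finS: "finite S" using S(1) fin by (rule finite_subset)
  have finM: "finite M" using SB fin unfolding M_def by (auto intro: finite_subset)
  have H: "H \<subseteq> S \<times> S" "sym H" "card H \<le> b * card S"
    using branch_adj_subset sym_branch_adj[OF sym] bound S(1) B
    unfolding H_def minors_bounded_def by blast+
  obtain I where I: "I \<subseteq> S" "\<And>u v. u \<in> I \<Longrightarrow> v \<in> I \<Longrightarrow> (u, v) \<notin> H \<or> u = v"
    "\<And>v. v \<in> I \<Longrightarrow> card (H `` {v}) \<le> 2 * b" "card S \<le> 2 * (2 * b + 1) * card I"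
    using low_degree_independent_set[OF finS H] by blast
  have finI: "finite I" using I(1) finS by (rule finite_subset)
  have Ipos: "card I > 0" using I(4) S(2) finS by (cases "card I = 0") auto
  define N where "N v = {w \<in> M. \<exists>z\<in>reach_in E U n v. (z, w) \<in> E}" for v
  have finN: "finite (N v)" for v using finM by (auto simp: N_def)
  \<comment> \<open>\<open>k\<close> is \<open>b\<close> times a bound on the ratio of
    \<open>card (I \<union> M)\<close> to \<open>card I\<close>. It comes from
    \<open>card M \<le> n * card H\<close>, \<open>card H \<le> b * card S\<close> and
    \<open>card S \<le> 2 * (2 * b + 1) * card I\<close>.\<close>
  define k where "k = b * (1 + n * b * (2 * (2 * b + 1)))"
  have "\<exists>v\<in>I. card (N v) \<le> k"
  proof (rule ccontr)
    assume "\<not> ?thesis"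
    then have large: "k + 1 \<le> card (N v)" if "v \<in> I" for v using that by (simp add: not_le Suc_le_eq)
    define D where "D v = (if v \<in> I then reach_in E U n v else {v})" for v
    define P where "P = Sigma I N"
    have IM: "I \<inter> M = {}" using I(1) by (auto simp: M_def)
    have UIM: "U \<inter> M = {}" "U \<inter> I = {}" using SB I(1) by (auto simp: M_def U_def)
    have "branch_sets V E n (I \<union> M) D"
      unfolding branch_sets_def
    proof (intro conjI ballI impI)
      fix v assume v: "v \<in> I \<union> M"
      show "v \<in> D v" by (simp add: D_def)
      have "v \<in> V" using v I(1) S(1) SB M_def by auto
      then show "D v \<subseteq> V"
        using reach_in_subset[of E U n v] unfolding D_def U_def by auto
      show "D v \<subseteq> reach_in E (D v) n v" using reach_in_idem by (auto simp: D_def)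
    next
      fix u v assume uv: "u \<in> I \<union> M" "v \<in> I \<union> M" "u \<noteq> v"
      \<comment> \<open>By saturation with \<open>x = y\<close>, a common vertex would make
        \<open>u\<close> and \<open>v\<close> adjacent in \<open>H\<close>, against the independence
        of \<open>I\<close>.\<close>
      have "reach_in E U n u \<inter> reach_in E U n v = {}" if "u \<in> I" "v \<in> I"
        using sat[of u v] that uv(3) I(1) I(2)[OF that] unfolding H_def U_def by blast
      moreover have "D z \<subseteq> insert z U" for z
        using reach_in_subset[of E U n z] unfolding D_def by auto
      ultimately show "D u \<inter> D v = {}"
        using uv UIM IM unfolding D_def using reach_in_subset[of E U n u] reach_in_subset[of E U n v]
        by (auto split: if_splits)
    qed
    moreover have "P \<union> P\<inverse> \<subseteq> branch_adj E (I \<union> M) D"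
    proof -
      have "P \<subseteq> branch_adj E (I \<union> M) D"
        using IM unfolding P_def N_def branch_adj_def D_def by auto
      then show ?thesis
        using sym_branch_adj[OF sym, of "I \<union> M" D] by (auto dest: symD)
    qed
    moreover have "I \<union> M \<subseteq> V" using I(1) S(1) SB by (auto simp: M_def)
    moreover have "sym (P \<union> P\<inverse>)" by (auto simp: sym_def)
    ultimately have "card (P \<union> P\<inverse>) \<le> b * card (I \<union> M)"
      using bound unfolding minors_bounded_def by blast
    moreover have "card (I \<union> M) \<le> card I + card M" by (rule card_Un_le)
    moreover have "card M \<le> n * b * (2 * (2 * b + 1)) * card I"
    proof -
      have "card M \<le> n * card H" using cardM by (simp add: M_def H_def)
      also have "\<dots> \<le> n * (b * (2 * (2 * b + 1) * card I))"
        using H(3) I(4) by (meson mult_le_mono2 order_trans)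
      finally show ?thesis by (simp add: algebra_simps)
    qed
    ultimately have "card (P \<union> P\<inverse>) \<le> b * (card I + n * b * (2 * (2 * b + 1)) * card I)"
      by (meson add_left_mono mult_le_mono2 order_trans)
    also have "\<dots> = k * card I" by (simp add: k_def algebra_simps)
    finally have "card (P \<union> P\<inverse>) \<le> k * card I" .
    moreover have "card P \<le> card (P \<union> P\<inverse>)"
      using finI finN by (intro card_mono) (auto simp: P_def)
    moreover have "card P \<ge> (k + 1) * card I"
      using finI finN sum_mono[of I "\<lambda>_. k + 1" "\<lambda>v. card (N v)"] large
      by (simp add: P_def mult.commute)
    ultimately have "(k + 1) * card I \<le> k * card I" by linarith
    then show False using Ipos by simp
  qed
  then obtain v where v: "v \<in> I" "card (N v) \<le> k" by blast
  have vS: "v \<in> S" using v I(1) by auto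
  define X where "X = N v \<union> H `` {v}"
  have "card X \<le> k + 2 * b"
    using card_Un_le[of "N v" "H `` {v}"] v(2) I(3)[OF v(1)] unfolding X_def by linarith
  moreover have "X \<subseteq> V" using H(1) S(1) SB by (auto simp: X_def N_def M_def)
  moreover have "separates V E n S v X"
    unfolding separates_def
  proof (intro ballI notI)
    fix x s assume x: "x \<in> reach_in E (V - (S - {v}) - X) n v" and s: "s \<in> S - {v} - X"
      and xs: "(x, s) \<in> E"
    \<comment> \<open>The walk avoids \<open>N v\<close>, so it cannot step into \<open>M\<close>,
      and it avoids \<open>S - {v}\<close>. Apart from returns to \<open>v\<close> it stays outside
      all branch sets.\<close>
    have "y \<in> reach_in E U m v" if "y \<in> reach_in E (V - (S - {v}) - X) m v" "m \<le> n" for y m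
      using that
    proof (induction m arbitrary: y)
      case 0
      then show ?case by simp
    next
      case (Suc m)
      show ?case
      proof (cases "y \<in> reach_in E (V - (S - {v}) - X) m v")
        case True
        then show ?thesis using Suc by auto
      next
        case False
        then obtain z where z: "z \<in> reach_in E U m v" "(z, y) \<in> E"
          and y: "y \<in> V - (S - {v}) - X"
          using Suc by auto
        have "z \<in> reach_in E U n v" using z(1) reach_in_mono[of U U m n E v] Suc.prems(2) by auto
        then have "y \<notin> M" using z(2) y by (auto simp: X_def N_def)
        then have "y = v \<or> y \<in> U" using y by (auto simp: M_def U_def)
        then show ?thesis
        proof
          assume "y = v" then show ?thesis using reach_in_self by metis
        qed (use z in auto)
      qed
    qed
    then have "x \<in> reach_in E U n v" using x by blast
    \<comment> \<open>Saturation is applied with \<open>s\<close> reached from itself in no step. It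
      makes \<open>s\<close> an \<open>H\<close>-neighbour of \<open>v\<close>, hence a member of
      \<open>X\<close>.\<close>
    then have "(v, s) \<in> H"
      using sat[of v s x s] xs s vS unfolding H_def U_def by auto
    then show False using s by (auto simp: X_def)
  qed
  ultimately show ?thesis using vS unfolding k_def by blast
qed

section \<open>Elimination orders and weak colouring numbers\<close>

text \<open>The vertex chosen for the whole of \<open>V\<close> gets the greatest rank and the rest
  is ordered recursively. Each initial segment is then a set for which its last element was the
  choice.\<close>

lemma elimination_order:
  assumes "finite V" and "\<And>S. S \<subseteq> V \<Longrightarrow> S \<noteq> {} \<Longrightarrow> \<exists>v\<in>S. P S v"
  shows "\<exists>rk :: 'a \<Rightarrow> nat. inj_on rk V \<and> (\<forall>v\<in>V. P {x \<in> V. rk x \<le> rk v} v)"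
  using assms
proof (induction "card V" arbitrary: V)
  case 0
  then show ?case by simp
next
  case (Suc n)
  then obtain v where v: "v \<in> V" "P V v" by (metis card.empty nat.distinct(1) order_refl)
  have "n = card (V - {v})" using Suc.hyps(2) v(1) Suc.prems(1) by simp
  moreover have "\<exists>u\<in>S. P S u" if "S \<subseteq> V - {v}" "S \<noteq> {}" for S
    using Suc.prems(2)[of S] that by blast
  ultimately obtain rk :: "'a \<Rightarrow> nat" where rk: "inj_on rk (V - {v})"
    "\<forall>u\<in>V - {v}. P {x \<in> V - {v}. rk x \<le> rk u} u"
    using Suc.hyps(1)[of "V - {v}"] Suc.prems(1) by auto
  define top where "top = Suc (Max (rk ` V))"
  have top: "rk u < top" if "u \<in> V" for u
    using that Suc.prems(1) by (simp add: top_def less_Suc_eq_le)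
  define rk' where "rk' = rk(v := top)"
  have "inj_on rk' V"
    using rk(1) top unfolding rk'_def inj_on_def
    by (metis DiffI fun_upd_apply less_irrefl singletonD)
  moreover have "P {x \<in> V. rk' x \<le> rk' u} u" if u: "u \<in> V" for u
  proof (cases "u = v")
    case True
    then have "{x \<in> V. rk' x \<le> rk' u} = V" using top by (auto simp: rk'_def less_imp_le)
    then show ?thesis using v True by simp
  next
    case False
    then have "{x \<in> V. rk' x \<le> rk' u} = {x \<in> V - {v}. rk x \<le> rk u}"
      using top[OF u] by (auto simp: rk'_def)
    then show ?thesis using rk(2) u False by simp
  qed
  ultimately show ?case by blast
qed

text \<open>These are the weakly \<open>n\<close>-reachable vertices from the theory of generalised
  colouring numbers. The condition \<open>rk w \<le> rk v\<close> is stated separately because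
  \<open>reach_in\<close> does not constrain the start.\<close>

definition weak_reach ::
    "'a set \<Rightarrow> ('a \<times> 'a) set \<Rightarrow> ('a \<Rightarrow> nat) \<Rightarrow> nat \<Rightarrow> 'a \<Rightarrow> 'a set" where
  "weak_reach V E rk n v =
     {w \<in> V. rk w \<le> rk v \<and> w \<in> reach_in E {x \<in> V. rk w \<le> rk x} n v}"

text \<open>A walk witnessing \<open>w \<noteq> v\<close> ends below \<open>v\<close>, so it has a
  first vertex \<open>x\<close> in \<open>S - {v} \<union> X v\<close>. At most \<open>r\<close>
  steps precede the edge into \<open>x\<close>, so separation puts \<open>x\<close> in
  \<open>X v\<close>. The rest of the walk stays above \<open>w\<close> and is shorter, which gives
  the recursion \<open>c (Suc n) \<le> 1 + k * c n\<close> for the maximum size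
  \<open>c n\<close>.\<close>

lemma card_weak_reach_le:
  assumes fin: "finite V"
    and sep: "\<And>v. v \<in> V \<Longrightarrow> X v \<subseteq> V \<and> card (X v) \<le> k \<and> separates V E r {x \<in> V. rk x \<le> rk v} v (X v)"
  shows "n \<le> Suc r \<Longrightarrow> v \<in> V \<Longrightarrow> card (weak_reach V E rk n v) \<le> (k + 1) ^ n"
proof (induction n arbitrary: v)
  case 0
  have "weak_reach V E rk 0 v \<subseteq> {v}" by (auto simp: weak_reach_def)
  then show ?case using card_mono[of "{v}"] by auto
next
  case (Suc n)
  have finX: "finite (X x)" if "x \<in> V" for x using sep[OF that] fin by (auto intro: finite_subset)
  have "weak_reach V E rk (Suc n) v \<subseteq> insert v (\<Union>x\<in>X v. weak_reach V E rk n x)"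
  proof
    fix w assume w: "w \<in> weak_reach V E rk (Suc n) v"
    show "w \<in> insert v (\<Union>x\<in>X v. weak_reach V E rk n x)"
    proof (cases "w = v")
      case False
      define U where "U = {x \<in> V. rk w \<le> rk x}"
      define S where "S = {x \<in> V. rk x \<le> rk v}"
      define Y where "Y = S - {v} \<union> X v"
      have wV: "w \<in> V" and wS: "w \<in> S - {v}" and wU: "w \<in> reach_in E U (Suc n) v"
        using w False by (auto simp: weak_reach_def S_def U_def)
      have "w \<notin> reach_in E (U - Y) (Suc n) v"
        using reach_in_subset[of E "U - Y" "Suc n" v] wS by (auto simp: Y_def)
      then obtain i z x where i: "i < Suc n" and z: "z \<in> reach_in E (U - Y) i v"
        and x: "x \<in> Y \<inter> U" "(z, x) \<in> E" "w \<in> reach_in E U (Suc n - Suc i) x"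
        using reach_in_first_hit[OF wU, of Y] by blast
      have "z \<in> reach_in E (V - (S - {v}) - X v) r v"
        by (rule subsetD[OF reach_in_mono z]) (use i Suc.prems in \<open>auto simp: U_def Y_def\<close>)
      then have "x \<in> X v"
        using sep[OF Suc.prems(2)] x(1,2) unfolding separates_def S_def[symmetric] Y_def by blast
      moreover have "w \<in> reach_in E U n x"
        by (rule subsetD[OF reach_in_mono x(3)]) auto
      then have "w \<in> weak_reach V E rk n x"
        using wV x(1) by (auto simp: weak_reach_def U_def)
      ultimately show ?thesis by blast
    qed simp
  qed
  moreover have "finite (insert v (\<Union>x\<in>X v. weak_reach V E rk n x))"
    using finX[OF Suc.prems(2)] fin by (auto simp: weak_reach_def)
  ultimately have "card (weak_reach V E rk (Suc n) v)
      \<le> card (insert v (\<Union>x\<in>X v. weak_reach V E rk n x))" by (rule card_mono[rotated])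
  also have "\<dots> \<le> Suc (card (\<Union>x\<in>X v. weak_reach V E rk n x))"
    by (rule card_insert_le_m1) simp_all
  also have "card (\<Union>x\<in>X v. weak_reach V E rk n x) \<le> (\<Sum>x\<in>X v. card (weak_reach V E rk n x))"
    by (rule card_UN_le[OF finX[OF Suc.prems(2)]])
  also have "\<dots> \<le> (\<Sum>x\<in>X v. (k + 1) ^ n)"
    using Suc sep[OF Suc.prems(2)] by (intro sum_mono) auto
  also have "\<dots> \<le> k * (k + 1) ^ n"
    using sep[OF Suc.prems(2)] by simp
  finally have "card (weak_reach V E rk (Suc n) v) \<le> Suc (k * (k + 1) ^ n)" by simp
  also have "\<dots> \<le> (k + 1) ^ Suc n" by simp
  finally show ?case .
qed

text \<open>Vertices are coloured by increasing rank. As \<open>v\<close> itself belongs to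
  \<open>N v\<close>, fewer than \<open>k\<close> colours are forbidden at \<open>v\<close>.\<close>

lemma greedy_coloring:
  fixes rk :: "'a \<Rightarrow> nat"
  assumes fin: "finite V" and inj: "inj_on rk V"
    and N: "\<And>v. v \<in> V \<Longrightarrow> N v \<subseteq> V \<and> v \<in> N v \<and> card (N v) \<le> k \<and> (\<forall>w\<in>N v. rk w \<le> rk v)"
  shows "\<exists>col :: 'a \<Rightarrow> nat. (\<forall>v\<in>V. col v < k) \<and> (\<forall>v\<in>V. \<forall>w\<in>N v. w \<noteq> v \<longrightarrow> col w \<noteq> col v)"
proof -
  have "\<exists>col :: 'a \<Rightarrow> nat. (\<forall>v\<in>V. rk v < m \<longrightarrow> col v < k \<and> (\<forall>w\<in>N v. w \<noteq> v \<longrightarrow> col w \<noteq> col v))" for m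
  proof (induction m)
    case 0
    then show ?case by simp
  next
    case (Suc m)
    then obtain col :: "'a \<Rightarrow> nat" where
      col: "\<And>v. v \<in> V \<Longrightarrow> rk v < m \<Longrightarrow> col v < k \<and> (\<forall>w\<in>N v. w \<noteq> v \<longrightarrow> col w \<noteq> col v)" by blast
    show ?case
    proof (cases "\<exists>v\<in>V. rk v = m")
      case False
      then show ?thesis using col by (intro exI[of _ col]) (auto simp: less_Suc_eq)
    next
      case True
      then obtain v where v: "v \<in> V" "rk v = m" by blast
      have finN: "finite (N v)" using N[OF v(1)] fin by (auto intro: finite_subset)
      have "card (col ` (N v - {v})) \<le> card (N v - {v})" by (rule card_image_le) (simp add: finN)
      also have "\<dots> < card (N v)" using N[OF v(1)] finN by (intro psubset_card_mono) auto
      also have "\<dots> \<le> card {..<k}" using N[OF v(1)] by simp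
      finally have "\<not> {..<k} \<subseteq> col ` (N v - {v})"
        using card_mono[of "col ` (N v - {v})" "{..<k}"] finN by auto
      then obtain c where c: "c < k" "c \<notin> col ` (N v - {v})" by auto
      have "(col(v := c)) u < k \<and> (\<forall>w\<in>N u. w \<noteq> u \<longrightarrow> (col(v := c)) w \<noteq> (col(v := c)) u)"
        if u: "u \<in> V" "rk u < Suc m" for u
      proof (cases "u = v")
        case True
        then show ?thesis using c by auto
      next
        case False
        then have "rk u \<noteq> m" using inj_onD[OF inj, of u v] v u(1) by auto
        then have "rk u < m" using u(2) by simp
        moreover from this have "v \<notin> N u" using N[OF u(1)] v(2) by auto
        ultimately show ?thesis using False col[OF u(1)] by auto
      qed
      then show ?thesis by blast
    qed
  qed
  from this[of "Suc (Max (rk ` V))"] fin show ?thesis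
    by (auto simp: less_Suc_eq_le)
qed

lemma weak_coloring:
  assumes fin: "finite V" and sym: "sym E" and bound: "minors_bounded V E n b"
  shows "\<exists>rk col :: 'a \<Rightarrow> nat.
    (\<forall>v\<in>V. col v < (b * (1 + n * b * (2 * (2 * b + 1))) + 2 * b + 1) ^ n) \<and>
    (\<forall>v\<in>V. \<forall>w\<in>weak_reach V E rk n v. w \<noteq> v \<longrightarrow> col w \<noteq> col v)"
proof -
  define k where "k = b * (1 + n * b * (2 * (2 * b + 1))) + 2 * b"
  have "\<exists>rk :: 'a \<Rightarrow> nat. inj_on rk V \<and>
    (\<forall>v\<in>V. \<exists>X\<subseteq>V. card X \<le> k \<and> separates V E n {x \<in> V. rk x \<le> rk v} v X)"
    using small_separator[OF fin sym bound] unfolding k_def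
    by (intro elimination_order[OF fin]) blast
  then obtain rk :: "'a \<Rightarrow> nat" where inj: "inj_on rk V"
    and "\<forall>v\<in>V. \<exists>X\<subseteq>V. card X \<le> k \<and> separates V E n {x \<in> V. rk x \<le> rk v} v X" by blast
  then obtain X where X: "\<And>v. v \<in> V \<Longrightarrow>
      X v \<subseteq> V \<and> card (X v) \<le> k \<and> separates V E n {x \<in> V. rk x \<le> rk v} v (X v)" by metis
  have "\<exists>col :: 'a \<Rightarrow> nat. (\<forall>v\<in>V. col v < (k + 1) ^ n) \<and>
      (\<forall>v\<in>V. \<forall>w\<in>weak_reach V E rk n v. w \<noteq> v \<longrightarrow> col w \<noteq> col v)"
  proof (rule greedy_coloring[OF fin inj])
    fix v assume v: "v \<in> V"
    then show "weak_reach V E rk n v \<subseteq> V \<and> v \<in> weak_reach V E rk n v \<and>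
        card (weak_reach V E rk n v) \<le> (k + 1) ^ n \<and> (\<forall>w\<in>weak_reach V E rk n v. rk w \<le> rk v)"
      using card_weak_reach_le[OF fin X, of n v] by (auto simp: weak_reach_def)
  qed
  then show ?thesis unfolding k_def by blast
qed

section \<open>Colouring the vertices by their least vertex towards a centre\<close>

text \<open>
  Every vertex \<open>x\<close> gets the colour of the least vertex \<open>m\<close> lying on a path of length at most \<open>d\<close>
  from \<open>x\<close> to \<open>A\<close>.  Two vertices with the same \<open>m\<close> share a centre, namely a vertex of \<open>A\<close> closest
  to \<open>m\<close>.  If \<open>x\<close> and \<open>y\<close> share a centre \<open>a\<close>, then on the walk from \<open>m x\<close> via \<open>x\<close>, \<open>a\<close>, \<open>y\<close> to
  \<open>m y\<close> no vertex is below both \<open>m x\<close> and \<open>m y\<close>, so one of them is weakly reachable from the other.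
\<close>

lemma common_center_coloring:
  fixes rk col :: "'a \<Rightarrow> nat"
  assumes sym: "sym E"
    and A: "A \<subseteq> V" and col: "\<forall>v\<in>V. col v < k"
    and proper: "\<forall>v\<in>V. \<forall>w\<in>weak_reach V E rk (4 * d) v. w \<noteq> v \<longrightarrow> col w \<noteq> col v"
  defines "near x y \<equiv> \<exists>a\<in>A. x \<in> reach_in E V d a \<and> y \<in> reach_in E V d a"
  shows "\<exists>f m. (\<forall>x\<in>V. near x x \<longrightarrow> f x < k) \<and>
    (\<forall>x\<in>V. \<forall>y\<in>V. near x x \<longrightarrow> near y y \<longrightarrow> f x = f y \<longrightarrow> (near x y \<longleftrightarrow> m x = (m y :: 'a)))"
proof -
  define Z where "Z x = {z \<in> V. \<exists>i j. i + j \<le> d \<and> z \<in> reach_in E V i x \<and> (\<exists>a\<in>A. z \<in> reach_in E V j a)}" for x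
  have swap: "x \<in> reach_in E V i y \<Longrightarrow> y \<in> V \<Longrightarrow> y \<in> reach_in E V i x" for x y i
    by (rule reach_in_sym[OF sym])
  \<comment> \<open>Going back one step from \<open>z\<close> towards \<open>x\<close> trades one
    unit of \<open>i\<close> for one of \<open>j\<close>. The whole path from \<open>x\<close> to
    \<open>z\<close> thus consists of vertices of \<open>Z x\<close>.\<close>
  have Zpath: "z \<in> reach_in E (Z x) i x"
    if "z \<in> reach_in E V i x" "z \<in> reach_in E V j a" "a \<in> A" "i + j \<le> d" "x \<in> V" for x z i j a
    using that
  proof (induction i arbitrary: z j)
    case 0
    then show ?case by simp
  next
    case (Suc i)
    show ?case
    proof (cases "z \<in> reach_in E V i x")
      case True
      have "i + j \<le> d" using Suc.prems(4) by simp
      from Suc.IH[OF True Suc.prems(2,3) this Suc.prems(5)] show ?thesis by simp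
    next
      case False
      then obtain y where y: "y \<in> reach_in E V i x" "(y, z) \<in> E" and z: "z \<in> V"
        using Suc.prems(1) by auto
      have yV: "y \<in> V" using y(1) Suc.prems(5) reach_in_subset[of E V i x] by auto
      have "(z, y) \<in> E" using y(2) sym by (auto dest: symD)
      then have "y \<in> reach_in E V (Suc j) a"
        by (rule reach_in_step[OF Suc.prems(2) _ yV lessI])
      moreover have "i + Suc j \<le> d" using Suc.prems(4) by simp
      ultimately have "y \<in> reach_in E (Z x) i x"
        using Suc.IH[OF y(1) _ Suc.prems(3) _ Suc.prems(5)] by blast
      moreover have "z \<in> Z x"
        using z Suc.prems(1-4) unfolding Z_def by blast
      ultimately show ?thesis using y(2) by auto
    qed
  qed
  have Zself: "x \<in> Z x" if x: "x \<in> V" "near x x" for x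
  proof -
    have "0 + d \<le> d" "x \<in> reach_in E V 0 x" by simp_all
    moreover have "\<exists>a\<in>A. x \<in> reach_in E V d a" using x(2) unfolding near_def by blast
    ultimately show ?thesis using x(1) unfolding Z_def by blast
  qed
  define m where "m x = arg_min rk (\<lambda>z. z \<in> Z x)" for x
  have m: "m x \<in> Z x" "Z x \<subseteq> {z \<in> V. rk (m x) \<le> rk z}" if "x \<in> V" "near x x" for x
  proof -
    show "m x \<in> Z x" unfolding m_def by (rule arg_min_natI[of "\<lambda>z. z \<in> Z x"]) (rule Zself[OF that])
    show "Z x \<subseteq> {z \<in> V. rk (m x) \<le> rk z}"
      unfolding m_def using arg_min_nat_le[of "\<lambda>z. z \<in> Z x" _ rk] by (auto simp: Z_def)
  qed
  have mV: "m x \<in> V" if "x \<in> V" "near x x" for x using m[OF that] by auto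
  have same: "near x y" if xy: "x \<in> V" "y \<in> V" "near x x" "near y y" "m x = m y" for x y
  proof -
    obtain i j a where 1: "i + j \<le> d" "m x \<in> reach_in E V i x" "a \<in> A" "m x \<in> reach_in E V j a"
      using m(1)[OF xy(1,3)] by (auto simp: Z_def)
    obtain i' j' a' where 2: "i' + j' \<le> d" "m x \<in> reach_in E V i' y" "a' \<in> A" "m x \<in> reach_in E V j' a'"
      using m(1)[OF xy(2,4)] xy(5) by (auto simp: Z_def)
    have *: "u \<in> reach_in E V d c" if "m x \<in> reach_in E V p u" "m x \<in> reach_in E V q c" "q + p \<le> d" "u \<in> V"
      for u c p q
      using reach_in_mono[OF subset_refl that(3)] reach_in_trans[OF swap[OF that(1,4)] that(2)] ..
    show ?thesis
    \<comment> \<open>Of the two centres, the one with the smaller bound on its distance to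
      \<open>m x\<close> is within distance \<open>d\<close> of both \<open>x\<close> and
      \<open>y\<close>, via \<open>m x\<close>.\<close>
    proof (cases "j \<le> j'")
      case True
      then show ?thesis
        using *[OF 1(2,4)] *[OF 2(2) 1(4)] 1(1,3) 2(1) xy(1,2) by (auto simp: near_def)
    next
      case False
      then show ?thesis
        using *[OF 2(2,4)] *[OF 1(2) 2(4)] 2(3) 1(1) 2(1) xy(1,2) by (auto simp: near_def)
    qed
  qed
  have reach: "m x \<in> weak_reach V E rk (4 * d) (m y)"
    if xy: "x \<in> V" "y \<in> V" "near x x" "near y y" "near x y" "rk (m x) \<le> rk (m y)" for x y
  proof -
    define U where "U = {z \<in> V. rk (m x) \<le> rk z}"
    have ZU: "Z x \<subseteq> U" "Z y \<subseteq> U"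
      using m(2)[OF xy(1,3)] m(2)[OF xy(2,4)] xy(6) by (auto simp: U_def)
    obtain a where a: "a \<in> A" "x \<in> reach_in E V d a" "y \<in> reach_in E V d a"
      using xy(5) by (auto simp: near_def)
    have aV: "a \<in> V" using a(1) A by auto
    have toa: "a \<in> reach_in E U d u" if "u \<in> V" "u \<in> reach_in E V d a" "Z u \<subseteq> U" for u
      using Zpath[of a d u 0 a] swap[OF that(2) aV] a(1) that(1) reach_in_mono[OF that(3), of d d E u]
      by auto
    have tom: "m u \<in> reach_in E U d u" if u: "u \<in> V" "near u u" "Z u \<subseteq> U" for u
    proof -
      obtain i j c where c: "i + j \<le> d" "m u \<in> reach_in E V i u" "c \<in> A" "m u \<in> reach_in E V j c"
        using m(1)[OF u(1,2)] by (auto simp: Z_def)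
      from Zpath[OF c(2,4,3,1) u(1)] show ?thesis
        using reach_in_mono[OF u(3), of i d E u] c(1) by auto
    qed
    \<comment> \<open>Reversing a walk inside \<open>U\<close> requires its start to lie in
      \<open>U\<close>.\<close>
    have inU: "x \<in> U" "y \<in> U" using Zself xy ZU by auto
    have "a \<in> reach_in E U d y" by (rule toa[OF xy(2) a(3) ZU(2)])
    moreover have "y \<in> reach_in E U d (m y)"
      by (rule reach_in_sym[OF sym inU(2) tom[OF xy(2,4) ZU(2)]])
    moreover have "x \<in> reach_in E U d a"
      by (rule reach_in_sym[OF sym inU(1) toa[OF xy(1) a(2) ZU(1)]])
    moreover have "m x \<in> reach_in E U d x" by (rule tom[OF xy(1,3) ZU(1)])
    \<comment> \<open>The four legs \<open>m y\<close> to \<open>y\<close>, \<open>y\<close> to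
      \<open>a\<close>, \<open>a\<close> to \<open>x\<close> and \<open>x\<close> to
      \<open>m x\<close> have length at most \<open>d\<close> each.\<close>
    ultimately have "m x \<in> reach_in E U (((d + d) + d) + d) (m y)"
      by (intro reach_in_trans)
    moreover have "((d + d) + d) + d = 4 * d" by simp
    ultimately have "m x \<in> reach_in E U (4 * d) (m y)" by metis
    then show ?thesis using xy(6) mV[OF xy(1,3)] by (simp add: weak_reach_def U_def)
  qed
  have "m x = m y" if xy: "x \<in> V" "y \<in> V" "near x x" "near y y" "near x y" "col (m x) = col (m y)" for x y
  proof (cases "rk (m x) \<le> rk (m y)")
    case True
    then show ?thesis using bspec[OF bspec[OF proper mV[OF xy(2,4)]] reach[OF xy(1-5)]] xy(6) by auto
  next
    case False
    have "near y x" using xy(5) by (auto simp: near_def)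
    then show ?thesis using bspec[OF bspec[OF proper mV[OF xy(1,3)]] reach[OF xy(2,1,4,3)]] xy(6) False
      by (metis nat_le_linear)
  qed
  then show ?thesis
    using same bspec[OF col mV] by (intro exI[of _ "\<lambda>x. col (m x)"] exI[of _ m]) metis
qed

section \<open>Distances, balls and depth minors in terms of \<open>reach_in\<close>\<close>

lemma awalk_imp_reach_in:
  assumes "pair_wf_digraph G"
  shows "pre_digraph.awalk (with_proj G) u p v \<Longrightarrow>
    v \<in> reach_in (parcs G) (pverts G) (length p) u"
proof (induction p arbitrary: u)
  case Nil
  then show ?case by (simp add: pre_digraph.awalk_def cas_with_proj_eq)
next
  case (Cons e p)
  interpret pair_wf_digraph G by fact
  have "awalk (snd e) p v" "e \<in> parcs G" "fst e = u"
    using Cons.prems by (auto simp: awalk_Cons_iff)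
  then show ?case
    using reach_in_Suc_left[of u "snd e" "parcs G" "pverts G" v "length p"] Cons.IH[of "snd e"]
      arc_snd_in_verts[of e] by (cases e) simp
qed

lemma reach_in_imp_awalk:
  assumes "pair_wf_digraph G" "u \<in> pverts G"
  shows "v \<in> reach_in (parcs G) (pverts G) n u \<Longrightarrow>
    \<exists>p. pre_digraph.awalk (with_proj G) u p v \<and> length p \<le> n"
proof (induction n arbitrary: v)
  case 0
  then show ?case using assms(2)
    by (intro exI[of _ "[]"]) (simp add: pre_digraph.awalk_def cas_with_proj_eq)
next
  case (Suc n)
  interpret pair_wf_digraph G by fact
  show ?case
  proof (cases "v \<in> reach_in (parcs G) (pverts G) n u")
    case True
    then show ?thesis using Suc.IH le_Suc_eq by blast
  next
    case False
    then obtain x where x: "x \<in> reach_in (parcs G) (pverts G) n u" "(x, v) \<in> parcs G"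
      using Suc.prems by auto
    from Suc.IH[OF x(1)] obtain p where p: "awalk u p x" "length p \<le> n" by blast
    have "awalk x [(x, v)] v"
      using x(2) by (simp add: awalk_Cons_iff awalk_Nil_iff in_arcsD2 in_arcsD1)
    with p have "awalk u (p @ [(x, v)]) v" by (auto intro: awalk_appendI)
    then show ?thesis using p(2) by (intro exI[of _ "p @ [(x, v)]"]) simp
  qed
qed

lemma graph_dist_le_iff:
  assumes "pair_wf_digraph G" "u \<in> pverts G"
  shows "graph_dist G u v \<le> ereal (real n) \<longleftrightarrow> v \<in> reach_in (parcs G) (pverts G) n u"
proof -
  interpret pair_wf_digraph G by fact
  have cost: "awalk_cost (\<lambda>_. 1) p = real (length p)" for p
    by (induction p) auto
  have dist: "graph_dist G u v = (INF p\<in>{p. awalk u p v}. ereal (real (length p)))"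
    unfolding graph_dist_def \<mu>_def cost ..
  show ?thesis
  proof
    assume "graph_dist G u v \<le> ereal (real n)"
    \<comment> \<open>The distance is an infimum over walks. The strict bound \<open>Suc n\<close>
      produces an actual walk, whose integral length is then at most \<open>n\<close>.\<close>
    also have "\<dots> < ereal (real (Suc n))" by simp
    finally obtain p where p: "awalk u p v" "length p < Suc n"
      unfolding dist INF_less_iff by auto
    then show "v \<in> reach_in (parcs G) (pverts G) n u"
      using awalk_imp_reach_in[OF assms(1) p(1)]
        reach_in_mono[OF subset_refl, of "length p" n "parcs G" "pverts G" u] by auto
  next
    assume "v \<in> reach_in (parcs G) (pverts G) n u"
    from reach_in_imp_awalk[OF assms this] obtain p where p: "awalk u p v" "length p \<le> n" by blast
    then show "graph_dist G u v \<le> ereal (real n)"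
      unfolding dist by (intro INF_lower2[of p]) auto
  qed
qed

lemma graph_ball_eq_reach_in:
  assumes "pair_wf_digraph G" "u \<in> pverts G"
  shows "graph_ball d G u = reach_in (parcs G) (pverts G) d u"
  using graph_dist_le_iff[OF assms] assms(2) reach_in_subset[of "parcs G" "pverts G" d u]
  unfolding graph_ball_def by auto

lemma reach_in_restrict:
  assumes "v \<in> U"
  shows "reach_in (E \<inter> U \<times> U) U n v = reach_in E U n v"
proof (induction n)
  case (Suc n)
  then show ?case using reach_in_subset[of E U n v] assms by auto
qed simp

text \<open>The model consists of the induced subgraphs on the branch sets. Short walks from the
  centre \<open>v\<close> give both connectedness and the radius bound.\<close>

lemma depth_minor_branch_sets:
  fixes G :: "'a pair_pre_digraph"
  assumes G: "pair_graph G" and B: "branch_sets (pverts G) (parcs G) n K B"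
    and R: "R \<subseteq> branch_adj (parcs G) K B"
  shows "depth_minor n \<lparr>pverts = K, parcs = R\<rparr> G"
proof -
  interpret pair_graph G by fact
  define \<eta> where "\<eta> v = \<lparr>pverts = B v, parcs = parcs G \<inter> B v \<times> B v\<rparr>" for v
  have "pair_graph (\<eta> v) \<and> subgraph (with_proj (\<eta> v)) (with_proj G) \<and>
    Digraph_Component.connected (with_proj (\<eta> v)) \<and> graph_radius (\<eta> v) \<le> ereal (real n)"
    if v: "v \<in> K" for v
  proof -
    have Bv: "v \<in> B v" "B v \<subseteq> pverts G" "B v \<subseteq> reach_in (parcs G) (B v) n v"
      using B v unfolding branch_sets_def by auto
    have symm: "sym (parcs G \<inter> B v \<times> B v)"
      using pair_sym_arcs by (auto simp: symmetric_def sym_def)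
    have fin: "finite (B v)" using Bv(2) pair_finite_verts by (rule finite_subset)
    interpret \<eta>: pair_graph "\<eta> v"
      using fin symm pair_no_loops unfolding \<eta>_def
      by unfold_locales (auto simp: symmetric_def)
    have reach: "x \<in> reach_in (parcs (\<eta> v)) (pverts (\<eta> v)) n v" if "x \<in> B v" for x
      using that Bv(3) reach_in_restrict[OF Bv(1), of "parcs G" n] by (auto simp: \<eta>_def)
    have sub: "subgraph (with_proj (\<eta> v)) (with_proj G)"
      using Bv(2) \<eta>.wf_digraph wf_digraph
      by (auto simp: subgraph_def compatible_def \<eta>_def)
    have to: "v \<rightarrow>\<^sup>*\<^bsub>with_proj (\<eta> v)\<^esub> x" if "x \<in> B v" for x
      using reach_in_imp_awalk[OF \<eta>.pair_wf_digraph _ reach[OF that]] Bv(1)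
      unfolding \<eta>.reachable_awalk by (auto simp: \<eta>_def)
    have "x \<rightarrow>\<^sup>*\<^bsub>with_proj (\<eta> v)\<^esub> y" if "x \<in> B v" "y \<in> B v" for x y
      by (rule \<eta>.reachable_trans[OF symmetric_reachable[OF \<eta>.pair_sym_arcs to[OF that(1)]] to[OF that(2)]])
    then have conn: "Digraph_Component.connected (with_proj (\<eta> v))"
      unfolding connected_def strongly_connected_def
        \<eta>.reachable_mk_symmetric_eq[OF \<eta>.pair_sym_arcs]
      using Bv(1) by (auto simp: mk_symmetric_def \<eta>_def)
    have "graph_radius (\<eta> v) \<le> (SUP x\<in>B v. graph_dist (\<eta> v) v x)"
      unfolding graph_radius_def by (rule INF_lower2[of v]) (use Bv(1) in \<open>auto simp: \<eta>_def\<close>)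
    also have "\<dots> \<le> ereal (real n)"
      using graph_dist_le_iff[OF \<eta>.pair_wf_digraph] reach Bv(1)
      by (intro SUP_least) (auto simp: \<eta>_def)
    finally show ?thesis using \<eta>.pair_graph sub conn by blast
  qed
  moreover have "pverts (\<eta> u) \<inter> pverts (\<eta> v) = {}" if "u \<in> K" "v \<in> K" "u \<noteq> v" for u v
    using B that unfolding branch_sets_def by (simp add: \<eta>_def)
  moreover have "\<exists>x\<in>pverts (\<eta> u). \<exists>y\<in>pverts (\<eta> v). (x, y) \<in> parcs G" if "(u, v) \<in> R" for u v
    using R that unfolding branch_adj_def by (auto simp: \<eta>_def)
  ultimately show ?thesis
    unfolding depth_minor_def by (intro exI[of _ \<eta>]) auto
qed

lemma average_degree_eq:
  assumes "finite K" "finite R" "R \<subseteq> K \<times> K"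
  shows "average_degree \<lparr>pverts = K, parcs = R\<rparr> = real (card R) / real (card K)"
proof -
  let ?H = "\<lparr>pverts = K, parcs = R\<rparr>"
  have "R = (\<Union>v\<in>K. out_arcs (with_proj ?H) v)"
    using assms(3) by (auto simp: out_arcs_def)
  then have "card R = card (\<Union>v\<in>K. out_arcs (with_proj ?H) v)" by simp
  also have "\<dots> = (\<Sum>v\<in>K. out_degree (with_proj ?H) v)"
    unfolding out_degree_def
    by (rule card_UN_disjoint) (use assms in \<open>auto simp: out_arcs_def\<close>)
  finally show ?thesis by (simp add: average_degree_def)
qed

lemma bounded_expansion_imp_minors_bounded:
  fixes \<C> :: "'a pair_pre_digraph set"
  assumes "\<forall>G\<in>\<C>. pair_graph G" "bounded_expansion \<C>"
  shows "\<exists>b. \<forall>G\<in>\<C>. minors_bounded (pverts G) (parcs G) n b"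
proof -
  obtain b :: real where b: "\<And>G H :: 'a pair_pre_digraph.
      G \<in> \<C> \<Longrightarrow> pair_graph H \<Longrightarrow> depth_minor n H G \<Longrightarrow> average_degree H \<le> b"
    using spec[OF assms(2)[unfolded bounded_expansion_def], of n] by blast
  have "card R \<le> nat \<lceil>b\<rceil> * card K"
    if G: "G \<in> \<C>" and K: "K \<subseteq> pverts G" and B: "branch_sets (pverts G) (parcs G) n K B"
      and R: "R \<subseteq> branch_adj (parcs G) K B" "sym R" for G K B R
  \<comment> \<open>The empty minor is treated apart, since the average degree is turned into a
    bound on \<open>card R\<close> by multiplying with \<open>card K\<close>.\<close>
  proof (cases "K = {}")
    case True
    then have "R = {}" using R(1) by (auto simp: branch_adj_def)
    then show ?thesis by simp
  next
    case False
    interpret pair_graph G using assms(1) G by blast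
    let ?H = "\<lparr>pverts = K, parcs = R\<rparr>"
    have finK: "finite K" using K pair_finite_verts by (rule finite_subset)
    have RK: "R \<subseteq> K \<times> K" using R(1) branch_adj_subset by (rule subset_trans)
    then have finR: "finite R" using finK by (auto intro: finite_subset)
    have "pair_graph ?H"
      using finK finR RK R
      by unfold_locales (auto simp: branch_adj_def symmetric_def)
    from b[OF G this depth_minor_branch_sets[OF pair_graph B R(1)]]
    have "real (card R) / real (card K) \<le> b"
      by (simp add: average_degree_eq[OF finK finR RK])
    then have "real (card R) \<le> b * real (card K)"
      using False finK by (simp add: divide_le_eq card_gt_0_iff)
    also have "\<dots> \<le> real (nat \<lceil>b\<rceil>) * real (card K)"
      by (intro mult_right_mono) (auto intro: real_nat_ceiling_ge)
    finally show ?thesis by (metis of_nat_le_iff of_nat_mult)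
  qed
  then show ?thesis unfolding minors_bounded_def by blast
qed

section \<open>Cluster graphs and the subcolouring of the Gaifman graph\<close>

text \<open>If adjacency is transitive on \<open>X\<close>, induction along a walk shows that its
  ends are equal or adjacent, so every component is complete.\<close>

lemma cluster_graphI:
  assumes G: "pair_graph G" and X: "X \<subseteq> pverts G"
    and trans: "\<And>x y z. \<lbrakk>x \<in> X; y \<in> X; z \<in> X; x \<noteq> z; (x, y) \<in> parcs G; (y, z) \<in> parcs G\<rbrakk>
      \<Longrightarrow> (x, z) \<in> parcs G"
  shows "cluster_graph (with_proj G \<restriction> X)"
  unfolding cluster_graph_def
proof
  interpret pair_graph G by fact
  fix K assume "K \<in> pre_digraph.sccs (with_proj G \<restriction> X)"
  then have K: "induced_subgraph K (with_proj G \<restriction> X)" "strongly_connected K"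
    by (auto simp: pre_digraph.sccs_def)
  then have VK: "verts K \<subseteq> X" and AK: "arcs K = {e \<in> parcs G. fst e \<in> verts K \<and> snd e \<in> verts K}"
    and wf: "wf_digraph K" and ends: "tail K = fst" "head K = snd"
    by (auto simp: induced_subgraph_def subgraph_def compatible_def)
  interpret K: wf_digraph K by fact
  have finK: "finite (verts K)" by (rule finite_subset[OF subset_trans[OF VK X] pair_finite_verts])
  have aeK: "arcs_ends K = parcs G \<inter> verts K \<times> verts K"
    by (auto simp: arcs_ends_conv ends AK)
  have "u = v \<or> (u, v) \<in> parcs G" if "u \<rightarrow>\<^sup>*\<^bsub>K\<^esub> v" for u v
    using that
  proof (induction rule: K.reachable_induct)
    case (step x y)
    have "(x, y) \<in> parcs G" "x \<in> verts K" "y \<in> verts K"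
      using step.hyps(2) unfolding aeK by simp_all
    moreover have "u \<in> verts K" using step.hyps(1) by (rule K.reachable_in_verts)
    ultimately show ?case using step.IH trans[of u x y] VK by (cases "u = x"; cases "u = y") auto
  qed simp
  then have "u = v \<or> (u, v) \<in> parcs G" if "u \<in> verts K" "v \<in> verts K" for u v
    using K(2) that unfolding strongly_connected_def by blast
  then have "arcs_ends K = {(u, v). (u, v) \<in> verts K \<times> verts K \<and> u \<noteq> v}"
    using pair_no_loops[of "(u, u)" for u] unfolding aeK by auto
  moreover have "graph K"
    using finK pair_finite_arcs pair_no_loops pair_sym_arcs
    by unfold_locales
      (auto simp: AK ends arc_to_ends_def symmetric_def aeK sym_def intro: prod_eqI)
  ultimately show "\<exists>n. complete_digraph n K"
    unfolding complete_digraph_def by blast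
qed

theorem theorem3p3:
  fixes d :: nat and \<C> :: "'a pair_pre_digraph set"
  assumes "\<forall>G\<in>\<C>. pair_graph G"
    and "bounded_expansion \<C>"
  shows "\<exists>s :: nat. \<forall>G\<in>\<C>. \<forall>W \<subseteq> pverts G. \<forall>Q \<subseteq> snd (balls_system d G).
           set_system_subchromatic_number (W, {F \<inter> W | F. F \<in> Q}) \<le> s"
proof -
  obtain b where b: "\<And>G. G \<in> \<C> \<Longrightarrow> minors_bounded (pverts G) (parcs G) (4 * d) b"
    using bounded_expansion_imp_minors_bounded[OF assms] by blast
  define s where "s = (b * (1 + 4 * d * b * (2 * (2 * b + 1))) + 2 * b + 1) ^ (4 * d)"
  have "set_system_subchromatic_number (W, {F \<inter> W | F. F \<in> Q}) \<le> s"
    if G: "G \<in> \<C>" and W: "W \<subseteq> pverts G" and Q: "Q \<subseteq> snd (balls_system d G)" for G W Q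
  proof -
    interpret pair_graph G using assms(1) G by blast
    define V where "V = pverts G"
    define E where "E = parcs G"
    have fin: "finite V" using pair_finite_verts by (simp add: V_def)
    have sym: "sym E" using pair_sym_arcs by (simp add: E_def symmetric_def)
    obtain rk col :: "'a \<Rightarrow> nat" where col: "\<forall>v\<in>V. col v < s"
      and proper: "\<forall>v\<in>V. \<forall>w\<in>weak_reach V E rk (4 * d) v. w \<noteq> v \<longrightarrow> col w \<noteq> col v"
      using weak_coloring[OF fin sym, of "4 * d" b] b[OF G] unfolding s_def V_def E_def by blast
    \<comment> \<open>Several centres may have the same ball; \<open>A\<close> contains all centres
      whose ball is in \<open>Q\<close>. Gaifman adjacency on \<open>W\<close> then means having a
      common centre in \<open>A\<close>.\<close>
    define A where "A = {a \<in> V. graph_ball d G a \<in> Q}"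
    define near where "near x y \<longleftrightarrow> (\<exists>a\<in>A. x \<in> reach_in E V d a \<and> y \<in> reach_in E V d a)" for x y
    have "A \<subseteq> V" by (auto simp: A_def)
    from common_center_coloring[OF sym this col proper]
    obtain f m where f: "\<And>x. x \<in> V \<Longrightarrow> near x x \<Longrightarrow> f x < s"
      and m: "\<And>x y. \<lbrakk>x \<in> V; y \<in> V; near x x; near y y; f x = f y\<rbrakk> \<Longrightarrow> near x y \<longleftrightarrow> m x = (m y :: 'a)"
      unfolding near_def by blast
    define \<Gamma> where "\<Gamma> = gaifman_graph (W, {F \<inter> W | F. F \<in> Q})"
    have ball: "graph_ball d G a = reach_in E V d a" if "a \<in> V" for a
      using graph_ball_eq_reach_in[OF pair_wf_digraph] that unfolding E_def V_def by blast
    have vert: "pverts \<Gamma> = W" by (simp add: \<Gamma>_def gaifman_graph_def)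
    have arc: "(x, y) \<in> parcs \<Gamma> \<longleftrightarrow> x \<in> W \<and> y \<in> W \<and> x \<noteq> y \<and> near x y" for x y
    proof -
      have "(\<exists>F\<in>Q. x \<in> F \<and> y \<in> F) \<longleftrightarrow> near x y"
      proof
        assume "\<exists>F\<in>Q. x \<in> F \<and> y \<in> F"
        then obtain F where F: "F \<in> Q" "x \<in> F" "y \<in> F" by blast
        then obtain a where a: "a \<in> V" "F = graph_ball d G a"
          using Q by (auto simp: balls_system_def V_def)
        then have "a \<in> A" using F(1) by (simp add: A_def)
        then show "near x y" using F(2,3) a ball unfolding near_def by blast
      next
        assume "near x y"
        then obtain a where "a \<in> A" "x \<in> reach_in E V d a" "y \<in> reach_in E V d a"
          unfolding near_def by blast
        then show "\<exists>F\<in>Q. x \<in> F \<and> y \<in> F" using ball by (auto simp: A_def)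
      qed
      then show ?thesis by (auto simp: \<Gamma>_def gaifman_graph_def)
    qed
    have near_sym: "near x y \<Longrightarrow> near y x" and near_refl: "near x y \<Longrightarrow> near x x" for x y
      unfolding near_def by blast+
    have finW: "finite W" using W pair_finite_verts by (rule finite_subset)
    have sub: "parcs \<Gamma> \<subseteq> W \<times> W" using arc by auto
    have "finite (parcs \<Gamma>)" by (rule finite_subset[OF sub]) (simp add: finW)
    then have \<Gamma>: "pair_graph \<Gamma>"
      using finW arc near_sym by unfold_locales (auto simp: vert symmetric_def sym_def)
    \<comment> \<open>A vertex covered by no ball of \<open>Q\<close> is isolated in
      \<open>\<Gamma>\<close>, so the default colour \<open>0\<close> does no harm. It is an
      admissible colour because \<open>s > 0\<close>.\<close>
    define g where "g x = (if near x x then f x else 0)" for x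
    have "cluster_graph (with_proj \<Gamma> \<restriction> {v \<in> pverts \<Gamma>. g v = i})" for i
    proof (rule cluster_graphI[OF \<Gamma>])
      fix x y z assume "x \<in> {v \<in> pverts \<Gamma>. g v = i}" "y \<in> {v \<in> pverts \<Gamma>. g v = i}"
        "z \<in> {v \<in> pverts \<Gamma>. g v = i}" and xz: "x \<noteq> z" and "(x, y) \<in> parcs \<Gamma>" "(y, z) \<in> parcs \<Gamma>"
      then have g: "g x = i" "g y = i" "g z = i" and xyz: "x \<in> W" "y \<in> W" "z \<in> W"
        and n: "near x y" "near y z"
        by (auto simp: arc vert)
      then have nn: "near x x" "near y y" "near z z" using near_sym near_refl by blast+
      then have "f x = f y" "f y = f z" using g by (auto simp: g_def)
      moreover have "x \<in> V" "y \<in> V" "z \<in> V" using xyz W unfolding V_def by blast+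
      \<comment> \<open>Within a colour class sharing a centre is the same as having equal
        \<open>m\<close>, which is an equivalence relation: \<open>m x = m y = m z\<close>.\<close>
      ultimately have "near x z" using m[of x y] m[of y z] m[of x z] n nn by simp
      then show "(x, z) \<in> parcs \<Gamma>" using xyz xz by (simp add: arc)
    qed auto
    moreover have "g ` pverts \<Gamma> \<subseteq> {..<s}"
    proof -
      have "s > 0" by (simp add: s_def)
      then show ?thesis using f W by (auto simp: vert g_def V_def)
    qed
    ultimately have "subcoloring \<Gamma> {..<s} g" unfolding subcoloring_def by blast
    then have "\<exists>(C :: nat set) f. subcoloring \<Gamma> C f \<and> card C = s"
      by (intro exI[of _ "{..<s}"] exI[of _ g]) simp
    then show ?thesis
      unfolding set_system_subchromatic_number_def subchromatic_number_def \<Gamma>_def[symmetric]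
      by (rule Least_le)
  qed
  then show ?thesis by blast
qed

end
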